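(* Let $C_{0,1,l}(N)$ ($1\le l\le N$) denote the coefficient of $(x-1)^{-l}$ in the partial fraction decomposition over $\mathbb{C}$ of $\prod_{j=1}^N \frac{1}{1-x^j}$. For integers $r\ge 0$ and $N\ge r+1$, define $P_{0,1,N-r}(N)$ by $$C_{0,1,N-r}(N) = \frac{(-1)^{N+r}}{4^r\, N!\, r!}\, P_{0,1,N-r}(N).$$ Then for any specific $r$, an explicit formula for $P_{0,1,N-r}(N)$ (as a function of $N$) may be given. In particular: (i) $P_{0,1,N}(N)=1$; (ii) $P_{0,1,N-1}(N)=N^2-N$; (iii) $P_{0,1,N-2}(N)=N^4-\frac{22}{9}N^3+\frac{13}{3}N^2-\frac{26}{9}N$; (iv) $P_{0,1,N-3}(N)=N^6-\frac{13}{3}N^5+\frac{43}{3}N^4-25N^3+\frac{98}{3}N^2-\frac{56}{3}N$; (v) $P_{0,1,N-4}(N)=N^8-\frac{20}{3}N^7+\frac{862}{27}N^6-\frac{21104}{225}N^5+\frac{29039}{135}N^4-\frac{14548}{45}N^3+\frac{9892}{27}N^2-\frac{42896}{225}N$.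
   Context: For each integer $N\ge 1$, the Rademacher coefficients $C_{h,k,l}(N)\in\mathbb{C}$ are the unique numbers satisfying $$\prod_{j=1}^N \frac{1}{1-x^j}=\sum_{k=1}^N\ \sum_{\substack{0\le h<k\\ \gcd(h,k)=1}}\ \sum_{l=1}^{\lfloor N/k\rfloor}\frac{C_{h,k,l}(N)}{(x-e^{2\pi i h/k})^l}.$$ For $k=1$ the only admissible $h$ is $h=0$ (since $\gcd(0,1)=1$), and $C_{0,1,l}(N)$ is the coefficient of $(x-1)^{-l}$. The subscript $N-r$ means that one counts down from the top-order pole at $x=1$, whose order is $N$. *)

theory Defs
  imports "HOL-Analysis.Analysis" "HOL-Computational_Algebra.Polynomial"
begin

text \<open>
  The identity of rational functions is read pointwise, at every complex number that is not a
  pole of the left-hand side. Those poles are exactly the points \<open>e\<^sup>2\<^sup>\<pi>\<^sup>i\<^sup>h\<^sup>/\<^sup>k\<close> occurring on the right,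
  so no division by zero is involved on either side.
\<close>

definition rademacher_decomposition :: "nat \<Rightarrow> (nat \<Rightarrow> nat \<Rightarrow> nat \<Rightarrow> complex) \<Rightarrow> bool" where
  "rademacher_decomposition N c \<longleftrightarrow>
     (\<forall>x::complex. (\<forall>j\<in>{1..N}. x ^ j \<noteq> 1) \<longrightarrow>
        (\<Prod>j=1..N. 1 / (1 - x ^ j)) =
        (\<Sum>k=1..N. \<Sum>h\<in>{h. h < k \<and> coprime h k}. \<Sum>l=1..N div k.
           c h k l / (x - exp (2 * of_real pi * \<i> * of_nat h / of_nat k)) ^ l))"

definition rademacher_index :: "nat \<Rightarrow> nat \<Rightarrow> nat \<Rightarrow> nat \<Rightarrow> bool" where
  "rademacher_index N h k l \<longleftrightarrow>
     1 \<le> k \<and> k \<le> N \<and> h < k \<and> coprime h k \<and> 1 \<le> l \<and> l \<le> N div k"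

text \<open>
  The decomposition only determines the coefficients at admissible indices; all others are set
  to 0 so that the family is unique as a total function.
\<close>

definition rademacher_coeff :: "nat \<Rightarrow> nat \<Rightarrow> nat \<Rightarrow> nat \<Rightarrow> complex" where
  "rademacher_coeff h k l N =
     (THE c. rademacher_decomposition N c \<and>
             (\<forall>h k l. \<not> rademacher_index N h k l \<longrightarrow> c h k l = 0)) h k l"

end

theory Submission
  imports Defs "HOL-Computational_Algebra.Computational_Algebra"
begin

text \<open>
  Put \<open>x = 1 + y\<close>. Then \<open>1 - x\<^sup>n\<^sup>+\<^sup>1 = - (n + 1) y A\<^sub>n(y)\<close> with
  \<open>A\<^sub>n(y) = (\<Sum>m\<le>n. (n choose m) / (m + 1) * y\<^sup>m)\<close> and \<open>A\<^sub>n(0) = 1\<close>, so the generating function is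
  \<open>(-1)\<^sup>N / N! * y\<^sup>-\<^sup>N * G\<^sub>N(y)\<close>, where \<open>G\<^sub>N\<close> is the reciprocal of \<open>A\<^sub>0 \<cdots> A\<^bsub>N-1\<^esub>\<close>.
  The coefficient of \<open>(x - 1)\<^sup>-\<^sup>(\<^sup>N\<^sup>-\<^sup>r\<^sup>)\<close> is therefore \<open>(-1)\<^sup>N / N!\<close> times the coefficient \<open>g\<^sub>r(N)\<close> of
  \<open>y\<^sup>r\<close> in \<open>G\<^sub>N\<close>, that is, \<open>P r N = (-4)\<^sup>r r! g\<^sub>r(N)\<close> (lemma \<open>rademacher_coeff_at_1\<close>).

  Comparing coefficients in \<open>A\<^sub>n G\<^bsub>n+1\<^esub> = G\<^sub>n\<close> gives (lemma \<open>reciprocal_coeff_Suc\<close>)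
  \<open>g\<^sub>r(n + 1) - g\<^sub>r(n) = - (\<Sum>m=1..r. (n choose m) / (m + 1) * g\<^bsub>r-m\<^esub>(n + 1))\<close>.
  By induction on \<open>r\<close> the right-hand side is a rational polynomial in \<open>n\<close>, and partial sums of such
  polynomials are again rational polynomials; hence so is \<open>g\<^sub>r\<close>. The same recurrence determines
  \<open>g\<^sub>1, \<dots>, g\<^sub>4\<close> from \<open>g\<^sub>0 = 1\<close> and \<open>g\<^sub>r(0) = 0\<close> for \<open>r > 0\<close>, so each explicit formula is a polynomial identity
  checked by induction on \<open>N\<close>.

  Because the Rademacher coefficients are defined by a definite description, none of this applies to
  them before the decomposition is known to exist and to be unique. Existence is the partial fraction
  theorem (\<open>partial_fractions_exist\<close>) together with the fact that \<open>e\<^sup>2\<^sup>\<pi>\<^sup>i\<^sup>h\<^sup>/\<^sup>k\<close>, with \<open>h\<close> and \<open>k\<close> coprime,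
  is a root of \<open>1 - x\<^sup>j\<close> exactly when \<open>k\<close> divides \<open>j\<close>, hence a root of the denominator of order
  \<open>N div k\<close>. Uniqueness, and the identification of the coefficients at \<open>x = 1\<close>, both follow from
  \<open>principal_part_coeff\<close>: a principal part is determined by the function near its pole.
\<close>

section \<open>Partial fractions\<close>

text \<open>
  Induction on the total order of the poles. At a pole \<open>s\<close> of order \<open>m s > 0\<close>, let \<open>R\<close> be the product
  over the other poles. With \<open>a = p(s) / R(s)\<close> the polynomial \<open>p - a R\<close> vanishes at \<open>s\<close>, so
  \<open>p = a R + (x - s) q\<close>: dividing by the denominator splits off \<open>a / (x - s)\<^bsup>m s\<^esup>\<close> and leaves \<open>q\<close>
  over a denominator with the order at \<open>s\<close> lowered by one.
\<close>
lemma partial_fractions_exist: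
  fixes p :: "'a::field poly"
  assumes "finite S" "p = 0 \<or> degree p < (\<Sum>z\<in>S. m z)"
  shows "\<exists>c. \<forall>x. x \<notin> S \<longrightarrow>
           poly p x / (\<Prod>z\<in>S. (x - z) ^ m z) = (\<Sum>z\<in>S. \<Sum>l=1..m z. c z l / (x - z) ^ l)"
  using assms(2)
proof (induction "\<Sum>z\<in>S. m z" arbitrary: m p)
  case 0
  then show ?case by (intro exI[of _ "\<lambda>_ _. 0"]) auto
next
  case (Suc n)
  obtain s where s: "s \<in> S" "m s > 0"
    using Suc.hyps(2) by (metis gr0I nat.distinct(1) sum.neutral)
  define R where "R = (\<Prod>z\<in>S - {s}. [:-z, 1:] ^ m z)"
  define a where "a = poly p s / poly R s"
  have R0: "poly R s \<noteq> 0"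
    using assms(1) by (auto simp: R_def poly_prod)
  have total: "Suc n = m s + (\<Sum>z\<in>S - {s}. m z)"
    using Suc.hyps(2) assms(1) s(1) by (simp add: sum.remove)
  have "poly (p - smult a R) s = 0"
    using R0 by (simp add: a_def)
  then obtain q where q: "p - smult a R = [:-s, 1:] * q"
    using poly_eq_0_iff_dvd by (metis dvdE)
  define m' where "m' = m(s := m s - 1)"
  have m'sum: "n = (\<Sum>z\<in>S. m' z)"
  proof -
    have "(\<Sum>z\<in>S. m' z) = m' s + (\<Sum>z\<in>S - {s}. m' z)"
      using assms(1) s(1) by (simp add: sum.remove)
    also have "(\<Sum>z\<in>S - {s}. m' z) = (\<Sum>z\<in>S - {s}. m z)"
      by (intro sum.cong) (auto simp: m'_def)
    finally show ?thesis using total s(2) by (simp add: m'_def)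
  qed
  have degq: "q = 0 \<or> degree q < (\<Sum>z\<in>S. m' z)"
  proof (rule disjCI)
    assume *: "\<not> degree q < (\<Sum>z\<in>S. m' z)"
    show "q = 0"
    proof (rule ccontr)
      assume "q \<noteq> 0"
      then have "degree (p - smult a R) = Suc (degree q)"
        unfolding q by (subst degree_mult_eq) auto
      moreover have "degree R \<le> (\<Sum>z\<in>S - {s}. m z)"
        unfolding R_def using assms(1)
        by (intro order.trans[OF degree_prod_sum_le] sum_mono)
           (auto intro!: order.trans[OF degree_power_le])
      then have "degree R < Suc n" using total s(2) by simp
      then have "degree (smult a R) < Suc n"
        by (rule le_less_trans[OF degree_smult_le])
      moreover have "degree p < Suc n" using Suc.prems Suc.hyps(2) by auto
      ultimately show False
        using * m'sum degree_diff_le_max[of p "smult a R"] by auto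
    qed
  qed
  obtain c where c: "\<And>x. x \<notin> S \<Longrightarrow> poly q x / (\<Prod>z\<in>S. (x - z) ^ m' z)
      = (\<Sum>z\<in>S. \<Sum>l=1..m' z. c z l / (x - z) ^ l)"
    using Suc.hyps(1)[OF m'sum degq] by blast
  define c' where "c' = c(s := (c s)(m s := a))"
  have "poly p x / (\<Prod>z\<in>S. (x - z) ^ m z) = (\<Sum>z\<in>S. \<Sum>l=1..m z. c' z l / (x - z) ^ l)"
    if x: "x \<notin> S" for x
  proof -
    have xs: "x - s \<noteq> 0" using x s(1) by auto
    have Rx: "poly R x = (\<Prod>z\<in>S - {s}. (x - z) ^ m z)"
      by (simp add: R_def poly_prod poly_power)
    have Rx0: "poly R x \<noteq> 0" using x assms(1) unfolding Rx by auto
    have Rx': "poly R x = (\<Prod>z\<in>S - {s}. (x - z) ^ m' z)"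
      unfolding Rx by (intro prod.cong) (auto simp: m'_def)
    have px: "poly p x = a * poly R x + (x - s) * poly q x"
      using arg_cong[OF q, of "\<lambda>t. poly t x"] by (simp add: algebra_simps)
    obtain k where k: "m s = Suc k" using s(2) gr0_implies_Suc by blast
    have "(\<Prod>z\<in>S. (x - z) ^ m z) = (x - s) ^ m s * poly R x"
      unfolding Rx using assms(1) s(1) by (simp add: prod.remove)
    then have "poly p x / (\<Prod>z\<in>S. (x - z) ^ m z)
        = a / (x - s) ^ m s + poly q x / ((x - s) ^ m' s * poly R x)"
      using xs Rx0 unfolding px k m'_def by (simp add: divide_simps k)
    also have "(x - s) ^ m' s * poly R x = (\<Prod>z\<in>S. (x - z) ^ m' z)"
      unfolding Rx' using assms(1) s(1) by (simp add: prod.remove)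
    also have "poly q x / \<dots> = (\<Sum>z\<in>S. \<Sum>l=1..m' z. c z l / (x - z) ^ l)"
      by (rule c[OF x])
    also have "\<dots> = (\<Sum>l=1..m' s. c s l / (x - s) ^ l)
        + (\<Sum>z\<in>S - {s}. \<Sum>l=1..m' z. c z l / (x - z) ^ l)"
      using assms(1) s(1) by (simp add: sum.remove)
    also have "(\<Sum>z\<in>S - {s}. \<Sum>l=1..m' z. c z l / (x - z) ^ l)
        = (\<Sum>z\<in>S - {s}. \<Sum>l=1..m z. c' z l / (x - z) ^ l)"
      by (intro sum.cong) (auto simp: m'_def c'_def)
    also have "a / (x - s) ^ m s + ((\<Sum>l=1..m' s. c s l / (x - s) ^ l) + \<dots>)
        = (\<Sum>l=1..m s. c' s l / (x - s) ^ l) + \<dots>"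
      by (simp add: k m'_def c'_def)
    also have "\<dots> = (\<Sum>z\<in>S. \<Sum>l=1..m z. c' z l / (x - z) ^ l)"
      using assms(1) s(1) by (simp add: sum.remove)
    finally show ?thesis .
  qed
  then show ?case by blast
qed

text \<open>
  If \<open>d\<close> is the order of vanishing of \<open>p\<close> at 0 and \<open>d < n\<close>, then \<open>p / y\<^sup>d\<close> has a nonzero limit at 0,
  whereas \<open>y\<^sup>n\<^sup>-\<^sup>d g\<close> tends to 0.
\<close>
lemma low_coeffs_vanish:
  fixes p :: "complex poly"
  assumes "(g \<longlongrightarrow> L) (at 0)" "\<forall>\<^sub>F y in at 0. poly p y = y ^ n * g y" "k < n"
  shows "coeff p k = 0"
proof (rule ccontr)
  assume k: "coeff p k \<noteq> 0"
  then have p: "p \<noteq> 0" by auto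
  define d where "d = order 0 p"
  have dn: "d < n"
    using k assms(3) monom_1_dvd_iff[OF p, of n] monom_1_dvd_iff'[of n p] by (auto simp: d_def)
  obtain q where q: "p = monom 1 d * q"
    using monom_1_dvd_iff[OF p, of d] unfolding d_def by (auto elim: dvdE)
  have q0: "poly q 0 \<noteq> 0"
  proof
    assume "poly q 0 = 0"
    then have "[:-0, 1:] dvd q" by (simp only: poly_eq_0_iff_dvd)
    then have "monom 1 d * [:-0, 1:] dvd p"
      unfolding q by (intro mult_dvd_mono) auto
    then have "monom 1 (Suc d) dvd p"
      by (simp add: monom_Suc)
    then show False using monom_1_dvd_iff[OF p, of "Suc d"] by (simp add: d_def)
  qed
  have "\<forall>\<^sub>F y in at 0. y ^ (n - d) * g y = poly q y"
  proof -
    have "\<forall>\<^sub>F y::complex in at 0. y \<noteq> 0" by (simp add: eventually_at_filter)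
    with assms(2) show ?thesis
    proof eventually_elim
      case (elim y)
      have "y ^ d * poly q y = y ^ d * (y ^ (n - d) * g y)"
        using elim(1) dn unfolding q by (simp add: poly_monom mult.assoc[symmetric] power_add[symmetric])
      then show ?case using elim(2) by simp
    qed
  qed
  moreover have "((\<lambda>y. y ^ (n - d) * g y) \<longlongrightarrow> 0 ^ (n - d) * L) (at 0)"
    by (intro tendsto_intros assms(1))
  ultimately have "(poly q \<longlongrightarrow> 0 ^ (n - d) * L) (at 0)"
    by (rule Lim_transform_eventually[rotated])
  moreover have "(poly q \<longlongrightarrow> poly q 0) (at 0)"
    by (intro tendsto_intros)
  ultimately have "poly q 0 = 0 ^ (n - d) * L"
    using LIM_unique by blast
  then show False using q0 dn by simp
qed

text \<open>
  Reads off a principal part as Taylor coefficients of the function with its pole removed. Multiplying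
  by \<open>y\<^sup>n A\<close> turns the principal part into a polynomial \<open>Q\<close> with \<open>Q A - K = - y\<^sup>n g A\<close>; by the
  previous lemma \<open>Q A\<close> and \<open>K\<close> then agree in degrees below \<open>n\<close>, so \<open>Q\<close> agrees there with \<open>K / A\<close> as a
  formal power series. With \<open>K = 0\<close> this is the uniqueness of principal parts.
\<close>
lemma principal_part_coeff:
  fixes a :: "nat \<Rightarrow> complex" and A :: "complex poly"
  assumes "poly A 0 \<noteq> 0" "(g \<longlongrightarrow> L) (at 0)"
    and "\<forall>\<^sub>F y in at 0. (\<Sum>l=1..n. a l / y ^ l) + g y = K / (y ^ n * poly A y)"
    and "r < n"
  shows "a (n - r) = K * inverse (fps_of_poly A) $ r"
proof -
  define Q where "Q = (\<Sum>i<n. monom (a (n - i)) i)"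
  define p where "p = Q * A - [:K:]"
  have Qy: "poly Q y = y ^ n * (\<Sum>l=1..n. a l / y ^ l)" if "y \<noteq> 0" for y
  proof -
    have "poly Q y = (\<Sum>i<n. a (n - i) * y ^ i)"
      by (simp add: Q_def poly_sum poly_monom)
    also have "\<dots> = (\<Sum>l=1..n. a l * y ^ (n - l))"
      by (rule sum.reindex_bij_witness[of _ "\<lambda>l. n - l" "\<lambda>i. n - i"]) auto
    also have "\<dots> = y ^ n * (\<Sum>l=1..n. a l / y ^ l)"
      unfolding sum_distrib_left by (intro sum.cong) (auto simp: power_diff that)
    finally show ?thesis .
  qed
  have Acont: "(poly A \<longlongrightarrow> poly A 0) (at 0)"
    by (intro tendsto_intros)
  have "\<forall>\<^sub>F y in at 0. poly A y \<noteq> 0"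
    using tendsto_imp_eventually_ne[OF Acont assms(1)] .
  moreover have "\<forall>\<^sub>F y::complex in at 0. y \<noteq> 0" by (simp add: eventually_at_filter)
  ultimately have "\<forall>\<^sub>F y in at 0. poly p y = y ^ n * - (g y * poly A y)"
    using assms(3)
  proof eventually_elim
    case (elim y)
    have "poly p y = y ^ n * ((\<Sum>l=1..n. a l / y ^ l) + g y) * poly A y - K
            + y ^ n * - (g y * poly A y)"
      using Qy[OF elim(2)] by (simp add: p_def algebra_simps)
    also have "y ^ n * ((\<Sum>l=1..n. a l / y ^ l) + g y) * poly A y - K = 0"
      unfolding elim(3) using elim(1,2) by simp
    finally show ?case by simp
  qed
  moreover have "((\<lambda>y. - (g y * poly A y)) \<longlongrightarrow> - (L * poly A 0)) (at 0)"
    by (intro tendsto_intros assms(2) Acont)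
  ultimately have low: "coeff p k = 0" if "k < n" for k
    using low_coeffs_vanish that by blast
  have QA: "(fps_of_poly Q * fps_of_poly A) $ k = (if k = 0 then K else 0)" if "k < n" for k
    using low[OF that] by (simp add: p_def fps_of_poly_mult[symmetric] coeff_pCons split: nat.splits)
  have A0: "fps_of_poly A $ 0 \<noteq> 0"
    using assms(1) by (simp add: poly_0_coeff_0)
  have "a (n - r) = coeff Q r"
    using assms(4) by (simp add: Q_def coeff_sum)
  also have "\<dots> = (fps_of_poly Q * fps_of_poly A * inverse (fps_of_poly A)) $ r"
    using inverse_mult_eq_1'[OF A0] by (simp add: mult.assoc)
  also have "\<dots> = (\<Sum>i=0..r. (if i = 0 then K else 0) * inverse (fps_of_poly A) $ (r - i))"
    unfolding fps_mult_nth[of "fps_of_poly Q * fps_of_poly A"]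
    using assms(4) QA by (intro sum.cong) auto
  also have "\<dots> = (\<Sum>i=0..r. if i = 0 then K * inverse (fps_of_poly A) $ r else 0)"
    by (intro sum.cong) auto
  also have "\<dots> = K * inverse (fps_of_poly A) $ r"
    by simp
  finally show ?thesis .
qed

section \<open>The poles and their orders\<close>

definition unity_root :: "nat \<Rightarrow> nat \<Rightarrow> complex" where
  "unity_root h k = exp (2 * of_real pi * \<i> * of_nat h / of_nat k)"

text \<open>
  The denominator comes first in each pair, because the range of the numerator depends on it.
\<close>
definition farey_pairs :: "nat \<Rightarrow> (nat \<times> nat) set" where
  "farey_pairs N = (SIGMA k:{1..N}. {h. h < k \<and> coprime h k})"

definition poles :: "nat \<Rightarrow> complex set" where
  "poles N = {z. \<exists>j\<in>{1..N}. z ^ j = 1}"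

definition denom_poly :: "nat \<Rightarrow> complex poly" where
  "denom_poly N = (\<Prod>j=1..N. 1 - monom 1 j)"

lemma finite_farey_pairs [simp]: "finite (farey_pairs N)"
  by (simp add: farey_pairs_def)

lemma finite_poles [simp]: "finite (poles N)"
proof -
  have "poles N = (\<Union>j\<in>{1..N}. {z. z ^ j = 1})" by (auto simp: poles_def)
  then show ?thesis by (auto intro!: finite_roots_unity)
qed

lemma unity_root_power_eq_1_iff:
  assumes "k \<ge> 1" "coprime h k"
  shows "unity_root h k ^ j = 1 \<longleftrightarrow> k dvd j"
proof -
  have "unity_root h k ^ j = exp (2 * of_real pi * \<i> * of_nat (h * j) / of_nat k)"
    by (simp add: unity_root_def exp_of_nat_mult[symmetric] mult_ac)
  also have "\<dots> = 1 \<longleftrightarrow> k dvd h * j"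
    by (rule complex_root_unity_eq_1[OF assms(1)])
  also have "\<dots> \<longleftrightarrow> k dvd j"
    using assms(2) by (simp add: coprime_dvd_mult_right_iff coprime_commute)
  finally show ?thesis .
qed

text \<open>
  The set of exponents \<open>j\<close> with \<open>z\<^sup>j = 1\<close> consists of the multiples of \<open>k\<close> and so recovers \<open>k\<close> from the
  root, which gives injectivity. Every root of unity arises by reducing its fraction to lowest terms.
\<close>
lemma bij_betw_farey_poles:
  "bij_betw (\<lambda>(k, h). unity_root h k) (farey_pairs N) (poles N)"
proof (rule bij_betw_imageI)
  show "inj_on (\<lambda>(k, h). unity_root h k) (farey_pairs N)"
  proof (rule inj_onI, clarify)
    fix k h k' h'
    assume *: "(k, h) \<in> farey_pairs N" "(k', h') \<in> farey_pairs N" "unity_root h k = unity_root h' k'"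
    have "k dvd j \<longleftrightarrow> k' dvd j" for j
      using * unity_root_power_eq_1_iff[of k h j] unity_root_power_eq_1_iff[of k' h' j]
      by (auto simp: farey_pairs_def)
    then have k: "k = k'" by (meson dvd_antisym dvd_refl)
    have "h mod k = h' mod k"
      using *(3) complex_root_unity_eq[of k h h'] *(1) k by (auto simp: unity_root_def farey_pairs_def)
    with * k show "k = k' \<and> h = h'" by (auto simp: farey_pairs_def)
  qed
  show "(\<lambda>(k, h). unity_root h k) ` farey_pairs N = poles N"
  proof (intro equalityI subsetI)
    fix z assume "z \<in> (\<lambda>(k, h). unity_root h k) ` farey_pairs N"
    then obtain k h where kh: "(k, h) \<in> farey_pairs N" "z = unity_root h k" by auto
    then have "z ^ k = 1" using unity_root_power_eq_1_iff[of k h k] by (auto simp: farey_pairs_def)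
    with kh show "z \<in> poles N" by (auto simp: poles_def farey_pairs_def)
  next
    fix z assume "z \<in> poles N"
    then obtain j where j: "1 \<le> j" "j \<le> N" "z ^ j = 1" by (auto simp: poles_def)
    then obtain i where i: "i < j" "z = exp (2 * of_real pi * \<i> * of_nat i / of_nat j)"
      using complex_roots_unity[OF j(1)] by blast
    define d where "d = gcd i j"
    have d: "d > 0" using j by (simp add: d_def)
    obtain h k where hk: "i = h * d" "j = k * d" "coprime h k"
      using gcd_coprime_exists[of i j] d unfolding d_def by (metis less_numeral_extra(3))
    have "z = unity_root h k"
      using d unfolding i(2) unity_root_def hk(1,2) by (simp add: mult.assoc)
    moreover have "(k, h) \<in> farey_pairs N"
    proof -
      have "k \<le> j" using hk(2) d by simp
      moreover have "k \<ge> 1" using hk(2) j(1) by (cases k) auto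
      moreover have "h < k" using i(1) hk(1,2) d by simp
      ultimately show ?thesis using j(2) hk(3) by (auto simp: farey_pairs_def)
    qed
    ultimately show "z \<in> (\<lambda>(k, h). unity_root h k) ` farey_pairs N" by force
  qed
qed

lemma denom_poly_nonzero: "denom_poly N \<noteq> 0"
proof -
  have "1 - monom 1 j \<noteq> (0 :: complex poly)" if "j \<ge> 1" for j :: nat
  proof
    assume "1 - monom 1 j = (0 :: complex poly)"
    then have "coeff (1 - monom 1 j) 0 = (0::complex)" by simp
    with that show False by simp
  qed
  then show ?thesis by (auto simp: denom_poly_def)
qed

lemma poly_denom_poly: "poly (denom_poly N) x = (\<Prod>j=1..N. 1 - x ^ j)"
  by (simp add: denom_poly_def poly_prod poly_monom)

lemma denom_poly_roots: "{z. poly (denom_poly N) z = 0} = poles N"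
  by (auto simp: poly_denom_poly poles_def)

lemma card_multiples_upto: "k \<ge> 1 \<Longrightarrow> card {j\<in>{1..N}. k dvd j} = N div k" for k N :: nat
proof -
  assume k: "k \<ge> 1"
  have "bij_betw (\<lambda>i. k * i) {1..N div k} {j\<in>{1..N}. k dvd j}"
    using k by (intro bij_betw_imageI)
      (auto simp: inj_on_def less_eq_div_iff_mult_less_eq mult.commute image_iff elim!: dvdE)
  then show ?thesis by (auto dest: bij_betw_same_card)
qed

lemma order_one_minus_monom:
  assumes "j \<ge> 1"
  shows "order z (1 - monom 1 j :: complex poly) = (if z ^ j = 1 then 1 else 0)"
proof -
  have "rsquarefree (1 - monom 1 j :: complex poly)"
    unfolding rsquarefree_roots using assms
    by (auto simp: poly_monom pderiv_diff pderiv_monom power_0_left)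
  moreover from this have "1 - monom 1 j \<noteq> (0 :: complex poly)" by (auto simp: rsquarefree_def)
  ultimately show ?thesis
    using rsquarefree_root_order[of "1 - monom 1 j" z] by (auto simp: poly_monom order_0I)
qed

lemma order_prod_sum:
  fixes f :: "'b \<Rightarrow> 'a::idom poly"
  assumes "finite A" "\<And>i. i \<in> A \<Longrightarrow> f i \<noteq> 0"
  shows "order z (\<Prod>i\<in>A. f i) = (\<Sum>i\<in>A. order z (f i))"
  using assms by (induction A rule: finite_induct) (auto simp: order_mult)

text \<open>
  Each factor \<open>1 - x\<^sup>j\<close> has only simple roots, so the order counts the \<open>j \<le> N\<close> that are multiples
  of \<open>k\<close>.
\<close>
lemma order_denom_poly:
  assumes "(k, h) \<in> farey_pairs N"
  shows "order (unity_root h k) (denom_poly N) = N div k"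
proof -
  have "order (unity_root h k) (denom_poly N)
      = (\<Sum>j=1..N. order (unity_root h k) (1 - monom 1 j))"
    unfolding denom_poly_def using denom_poly_nonzero[of N]
    by (intro order_prod_sum) (auto simp: denom_poly_def)
  also have "\<dots> = (\<Sum>j=1..N. if k dvd j then 1 else 0)"
    using assms by (intro sum.cong) (auto simp: order_one_minus_monom unity_root_power_eq_1_iff farey_pairs_def)
  also have "\<dots> = card {j\<in>{1..N}. k dvd j}"
    by (simp add: sum.If_cases Int_def)
  also have "\<dots> = N div k" using assms by (intro card_multiples_upto) (auto simp: farey_pairs_def)
  finally show ?thesis .
qed

section \<open>Existence and uniqueness of the decomposition\<close>

lemma rademacher_decomposition_alt:
  "rademacher_decomposition N c \<longleftrightarrow>
     (\<forall>x. x \<notin> poles N \<longrightarrow> 1 / poly (denom_poly N) x =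
        (\<Sum>(k, h)\<in>farey_pairs N. \<Sum>l=1..N div k. c h k l / (x - unity_root h k) ^ l))"
  unfolding rademacher_decomposition_def poles_def farey_pairs_def unity_root_def poly_denom_poly
  by (subst sum.Sigma[symmetric]) (auto simp: prod_dividef)

lemma farey_pairs_iff_index:
  "1 \<le> l \<Longrightarrow> l \<le> N div k \<Longrightarrow> (k, h) \<in> farey_pairs N \<longleftrightarrow> rademacher_index N h k l"
  by (auto simp: farey_pairs_def rademacher_index_def)

lemma rademacher_decomposition_exists:
  assumes "N \<ge> 1"
  shows "\<exists>c. rademacher_decomposition N c \<and> (\<forall>h k l. \<not> rademacher_index N h k l \<longrightarrow> c h k l = 0)"
proof -
  define u where "u = lead_coeff (denom_poly N)"
  define m where "m = (\<lambda>z. order z (denom_poly N))"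
  have u: "u \<noteq> 0" using denom_poly_nonzero by (simp add: u_def)
  have decomp: "poly (denom_poly N) x = u * (\<Prod>z\<in>poles N. (x - z) ^ m z)" for x
    by (subst complex_poly_decompose[of "denom_poly N", symmetric])
       (simp add: denom_poly_roots poly_prod poly_power u_def m_def)
  have one: "1 \<in> poles N" using assms by (auto simp: poles_def)
  have "m 1 \<noteq> 0"
    using one denom_poly_nonzero[of N] unfolding m_def denom_poly_roots[symmetric]
    by (simp add: order_root)
  then have "0 < (\<Sum>z\<in>poles N. m z)"
    using one by (metis finite_poles gr0I sum_eq_0_iff)
  then have "[:1 / u:] = 0 \<or> degree [:1 / u:] < (\<Sum>z\<in>poles N. m z)"
    by simp
  \<comment> \<open>The numerator is a constant, so the degree condition only asks for at least one pole.\<close>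
  from partial_fractions_exist[OF finite_poles this] obtain c where
    c: "\<And>x. x \<notin> poles N \<Longrightarrow> poly [:1 / u:] x / (\<Prod>z\<in>poles N. (x - z) ^ m z)
          = (\<Sum>z\<in>poles N. \<Sum>l=1..m z. c z l / (x - z) ^ l)"
    by blast
  define c' where "c' h k l = (if rademacher_index N h k l then c (unity_root h k) l else 0)" for h k l
  have "rademacher_decomposition N c'"
    unfolding rademacher_decomposition_alt
  proof (intro allI impI)
    fix x assume x: "x \<notin> poles N"
    have "1 / poly (denom_poly N) x = (\<Sum>z\<in>poles N. \<Sum>l=1..m z. c z l / (x - z) ^ l)"
      using c[OF x] by (simp add: decomp divide_simps)
    also have "\<dots> = (\<Sum>i\<in>farey_pairs N. case i of (k, h) \<Rightarrow>
        \<Sum>l=1..m (unity_root h k). c (unity_root h k) l / (x - unity_root h k) ^ l)"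
      by (subst sum.reindex_bij_betw[OF bij_betw_farey_poles, symmetric])
         (simp add: case_prod_unfold)
    also have "\<dots> = (\<Sum>(k, h)\<in>farey_pairs N. \<Sum>l=1..N div k. c' h k l / (x - unity_root h k) ^ l)"
      by (intro sum.cong refl)
         (auto simp: m_def order_denom_poly c'_def farey_pairs_iff_index intro!: sum.cong)
    finally show "1 / poly (denom_poly N) x = \<dots>" .
  qed
  then show ?thesis by (intro exI[of _ c']) (auto simp: c'_def)
qed

text \<open>
  The terms belonging to the other poles have a limit at the given one, since distinct index pairs
  give distinct poles. This isolates the principal part in the form that
  \<open>principal_part_coeff\<close> expects.
\<close>
lemma principal_part_at_pole:
  assumes "rademacher_decomposition N c" "(k, h) \<in> farey_pairs N"
  shows "\<exists>g L. (g \<longlongrightarrow> L) (at 0) \<and>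
    (\<forall>\<^sub>F y in at 0. (\<Sum>l=1..N div k. c h k l / y ^ l) + g y = 1 / poly (denom_poly N) (unity_root h k + y))"
proof -
  define w where "w = unity_root h k"
  define g where "g y = (\<Sum>(k', h')\<in>farey_pairs N - {(k, h)}.
      \<Sum>l=1..N div k'. c h' k' l / (w + y - unity_root h' k') ^ l)" for y
  have "(g \<longlongrightarrow> (\<Sum>(k', h')\<in>farey_pairs N - {(k, h)}.
      \<Sum>l=1..N div k'. c h' k' l / (w + 0 - unity_root h' k') ^ l)) (at 0)"
    unfolding g_def case_prod_unfold
  proof (intro tendsto_sum tendsto_intros)
    fix i l
    assume *: "i \<in> farey_pairs N - {(k, h)}"
    then have "w \<noteq> unity_root (snd i) (fst i)"
      using bij_betw_farey_poles[of N] assms(2)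
      by (force simp: bij_betw_def inj_on_def w_def case_prod_unfold)
    then show "(w + 0 - unity_root (snd i) (fst i)) ^ l \<noteq> 0" by simp
  qed
  moreover have "\<forall>\<^sub>F y in at 0. (\<Sum>l=1..N div k. c h k l / y ^ l) + g y
      = 1 / poly (denom_poly N) (w + y)"
  proof -
    (* the other poles, translated by -w, form a finite, hence closed, set that avoids 0 *)
    have "open (- ((\<lambda>z. z - w) ` (poles N - {w})))"
      by (intro open_Compl finite_imp_closed) auto
    then have "\<forall>\<^sub>F y in at 0. w + y \<notin> poles N"
      unfolding eventually_at_topological
      by (intro exI[of _ "- ((\<lambda>z. z - w) ` (poles N - {w}))"]) (force simp: image_iff)
    then show ?thesis
    proof eventually_elim
      case (elim y)
      then have "1 / poly (denom_poly N) (w + y) =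
        (\<Sum>(k, h)\<in>farey_pairs N. \<Sum>l=1..N div k. c h k l / (w + y - unity_root h k) ^ l)"
        using assms(1) unfolding rademacher_decomposition_alt by blast
      also have "\<dots> = (\<Sum>l=1..N div k. c h k l / (w + y - unity_root h k) ^ l) + g y"
        unfolding g_def by (subst sum.remove[OF _ assms(2)]) auto
      finally show ?case by (simp add: w_def)
    qed
  qed
  ultimately show ?thesis unfolding w_def by blast
qed

lemma rademacher_decomposition_unique:
  assumes "rademacher_decomposition N c" "rademacher_decomposition N c'" "rademacher_index N h k l"
  shows "c h k l = c' h k l"
proof -
  have l: "1 \<le> l" "l \<le> N div k" "(k, h) \<in> farey_pairs N"
    using assms(3) by (auto simp: rademacher_index_def farey_pairs_def)
  obtain g L where g: "(g \<longlongrightarrow> L) (at 0)"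
    "\<forall>\<^sub>F y in at 0. (\<Sum>l=1..N div k. c h k l / y ^ l) + g y = 1 / poly (denom_poly N) (unity_root h k + y)"
    using principal_part_at_pole[OF assms(1) l(3)] by blast
  obtain g' L' where g': "(g' \<longlongrightarrow> L') (at 0)"
    "\<forall>\<^sub>F y in at 0. (\<Sum>l=1..N div k. c' h k l / y ^ l) + g' y = 1 / poly (denom_poly N) (unity_root h k + y)"
    using principal_part_at_pole[OF assms(2) l(3)] by blast
  have "\<forall>\<^sub>F y in at 0. (\<Sum>l=1..N div k. (c h k l - c' h k l) / y ^ l) + (g y - g' y)
      = 0 / (y ^ (N div k) * poly 1 y)"
    using g(2) g'(2)
    by eventually_elim (simp add: diff_divide_distrib sum_subtractf algebra_simps)
  \<comment> \<open>Index \<open>N div k - l\<close>, since the coefficients are counted down from the top order \<open>N div k\<close>.\<close>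
  from principal_part_coeff[OF _ tendsto_diff[OF g(1) g'(1)] this, of "N div k - l"] l
  show ?thesis by simp
qed

lemma rademacher_coeff_decomposition:
  assumes "N \<ge> 1"
  shows "rademacher_decomposition N (\<lambda>h k l. rademacher_coeff h k l N)"
proof -
  let ?Q = "\<lambda>c. rademacher_decomposition N c \<and> (\<forall>h k l. \<not> rademacher_index N h k l \<longrightarrow> c h k l = 0)"
  have "\<exists>!c. ?Q c"
  proof (rule ex_ex1I)
    show "\<exists>c. ?Q c" by (rule rademacher_decomposition_exists[OF assms])
    show "c = c'" if "?Q c" "?Q c'" for c c'
    proof (intro ext)
      fix h k l
      show "c h k l = c' h k l"
        using that rademacher_decomposition_unique[of N c c' h k l]
        by (cases "rademacher_index N h k l") auto
    qed
  qed
  then have "?Q (THE c. ?Q c)" by (rule theI')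
  then show ?thesis by (simp add: rademacher_coeff_def)
qed

section \<open>Taylor expansion at the pole 1\<close>

text \<open>
  This is \<open>((1 + y)\<^sup>n\<^sup>+\<^sup>1 - 1) / ((n + 1) y)\<close>, so the index \<open>n\<close> belongs to the factor \<open>1 - x\<^sup>n\<^sup>+\<^sup>1\<close>. With this
  shift the coefficients are polynomials in \<open>n\<close> without any denominator depending on \<open>n\<close>.
\<close>
definition shifted_factor :: "nat \<Rightarrow> complex poly" where
  "shifted_factor n = (\<Sum>m\<le>n. monom (of_nat (n choose m) / of_nat (Suc m)) m)"

definition reciprocal_coeff :: "nat \<Rightarrow> nat \<Rightarrow> complex" where
  "reciprocal_coeff r N = inverse (fps_of_poly (\<Prod>n<N. shifted_factor n)) $ r"

lemma coeff_shifted_factor: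
  "coeff (shifted_factor n) m = of_nat (n choose m) / of_nat (Suc m)"
  by (simp add: shifted_factor_def coeff_sum)

lemma one_minus_power_shifted:
  "1 - (1 + y) ^ Suc n = - (of_nat (Suc n) * y * poly (shifted_factor n) y)"
proof -
  have "of_nat (Suc n) * y * poly (shifted_factor n) y
      = (\<Sum>m\<le>n. of_nat (Suc n) * (of_nat (n choose m) / of_nat (Suc m)) * y ^ Suc m)"
    by (simp add: shifted_factor_def poly_sum poly_monom sum_distrib_left mult_ac del: of_nat_Suc)
  also have "\<dots> = (\<Sum>m\<le>n. of_nat (Suc n choose Suc m) * y ^ Suc m)"
  proof (intro sum.cong refl)
    fix m
    have "(of_nat (Suc n) * of_nat (n choose m) :: complex) = of_nat (Suc n choose Suc m) * of_nat (Suc m)"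
      using Suc_times_binomial_eq[of n m] by (metis of_nat_mult)
    then have "of_nat (Suc n) * (of_nat (n choose m) / of_nat (Suc m)) = (of_nat (Suc n choose Suc m) :: complex)"
      by (simp add: field_simps del: of_nat_Suc binomial_Suc_Suc)
    then show "of_nat (Suc n) * (of_nat (n choose m) / of_nat (Suc m)) * y ^ Suc m
        = of_nat (Suc n choose Suc m) * y ^ Suc m"
      by simp
  qed
  also have "\<dots> = (\<Sum>m\<le>Suc n. of_nat (Suc n choose m) * y ^ m) - 1"
    using sum.atMost_Suc_shift[of "\<lambda>m. of_nat (Suc n choose m) * y ^ m" n]
    by (simp del: binomial_Suc_Suc power_Suc sum.atMost_Suc)
  also have "(\<Sum>m\<le>Suc n. of_nat (Suc n choose m) * y ^ m) = (1 + y) ^ Suc n"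
    by (subst add.commute, subst binomial_ring) simp
  finally show ?thesis by simp
qed

lemma denom_poly_shifted:
  "poly (denom_poly N) (1 + y)
     = (-1) ^ N * fact N * (y ^ N * poly (\<Prod>n<N. shifted_factor n) y)"
proof -
  have "poly (denom_poly N) (1 + y) = (\<Prod>n<N. 1 - (1 + y) ^ Suc n)"
    unfolding poly_denom_poly
    by (rule prod.reindex_bij_witness[of _ Suc "\<lambda>j. j - 1"]) auto
  also have "\<dots> = (\<Prod>n<N. (- 1) * of_nat (Suc n) * (y * poly (shifted_factor n) y))"
    unfolding one_minus_power_shifted by (intro prod.cong refl) (simp add: algebra_simps)
  also have "\<dots> = (-1) ^ N * (\<Prod>n<N. of_nat (Suc n)) * (y ^ N * poly (\<Prod>n<N. shifted_factor n) y)"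
    unfolding prod.distrib poly_prod by simp
  also have "(\<Prod>n<N. of_nat (Suc n)) = (fact N :: complex)"
    unfolding fact_prod_Suc by (simp add: lessThan_atLeast0)
  finally show ?thesis .
qed

lemma shifted_product_at_0: "poly (\<Prod>n<N. shifted_factor n) 0 = 1"
proof -
  have "poly (shifted_factor n) 0 = 1" for n
    by (simp add: poly_0_coeff_0 coeff_shifted_factor)
  then show ?thesis by (simp add: poly_prod)
qed

lemma rademacher_coeff_at_1:
  assumes "r < N"
  shows "rademacher_coeff 0 1 (N - r) N = (-1) ^ N / fact N * reciprocal_coeff r N"
proof -
  have N: "N \<ge> 1" using assms by simp
  have 1: "(1, 0) \<in> farey_pairs N" using N by (auto simp: farey_pairs_def)
  have w: "unity_root 0 1 = 1" by (simp add: unity_root_def)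
  obtain g L where g: "(g \<longlongrightarrow> L) (at 0)"
    "\<forall>\<^sub>F y in at 0. (\<Sum>l=1..N div 1. rademacher_coeff 0 1 l N / y ^ l) + g y
       = 1 / poly (denom_poly N) (unity_root 0 1 + y)"
    using principal_part_at_pole[OF rademacher_coeff_decomposition[OF N] 1] by blast
  have "\<forall>\<^sub>F y in at 0. (\<Sum>l=1..N. rademacher_coeff 0 1 l N / y ^ l) + g y
       = ((-1) ^ N / fact N) / (y ^ N * poly (\<Prod>n<N. shifted_factor n) y)"
    using g(2) unfolding w denom_poly_shifted
    by eventually_elim (simp add: minus_one_power_iff)
  from principal_part_coeff[OF _ g(1) this assms] show ?thesis
    by (simp add: shifted_product_at_0 reciprocal_coeff_def)
qed

lemma reciprocal_coeff_0_right: "reciprocal_coeff r 0 = (if r = 0 then 1 else 0)"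
  by (simp add: reciprocal_coeff_def)

lemma reciprocal_coeff_0_left: "reciprocal_coeff 0 N = 1"
  using shifted_product_at_0[of N] by (simp add: reciprocal_coeff_def poly_0_coeff_0)

text \<open>
  Passing from \<open>n\<close> to \<open>n + 1\<close> factors multiplies the reciprocal series \<open>G\<close> by \<open>1 / A\<^sub>n\<close>. Written as
  \<open>G\<^sub>n = A\<^sub>n G\<^bsub>n+1\<^esub>\<close>, this involves only the coefficients of \<open>A\<^sub>n\<close> and not those of its inverse, at the price of
  the argument \<open>n + 1\<close> on the right-hand side.
\<close>
lemma reciprocal_coeff_Suc:
  "reciprocal_coeff r (Suc n) = reciprocal_coeff r n
     - (\<Sum>m=1..r. of_nat (n choose m) / of_nat (Suc m) * reciprocal_coeff (r - m) (Suc n))"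
proof -
  define F where "F N = fps_of_poly (\<Prod>n<N. shifted_factor n)" for N
  have F0: "F N $ 0 \<noteq> 0" for N
    using shifted_product_at_0[of N] by (simp add: F_def poly_0_coeff_0)
  have F_Suc: "F (Suc n) = fps_of_poly (shifted_factor n) * F n"
    by (simp add: F_def fps_of_poly_mult mult.commute)
  have "inverse (F n) = inverse (F n) * (F (Suc n) * inverse (F (Suc n)))"
    by (simp only: inverse_mult_eq_1'[OF F0] mult_1_right)
  also have "\<dots> = (inverse (F n) * F n) * (fps_of_poly (shifted_factor n) * inverse (F (Suc n)))"
    by (simp add: F_Suc mult_ac)
  also have "\<dots> = fps_of_poly (shifted_factor n) * inverse (F (Suc n))"
    using inverse_mult_eq_1[OF F0] by simp
  finally have "reciprocal_coeff r n = (\<Sum>m=0..r. of_nat (n choose m) / of_nat (Suc m) * reciprocal_coeff (r - m) (Suc n))"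
    by (simp add: reciprocal_coeff_def F_def fps_mult_nth coeff_shifted_factor)
  also have "\<dots> = reciprocal_coeff r (Suc n) + (\<Sum>m=1..r. of_nat (n choose m) / of_nat (Suc m) * reciprocal_coeff (r - m) (Suc n))"
    by (subst sum.atLeast_Suc_atMost) auto
  finally show ?thesis by simp
qed

section \<open>Polynomial dependence on N\<close>

text \<open>
  Polynomial functions on the naturals with rational coefficients, taken with complex values so that
  the closure properties apply directly to the reciprocal coefficients.
\<close>
definition rat_polyfun :: "(nat \<Rightarrow> complex) \<Rightarrow> bool" where
  "rat_polyfun f \<longleftrightarrow> (\<exists>p :: rat poly. \<forall>n. f n = of_rat (poly p (of_nat n)))"

lemma rat_polyfun_of_rat: "rat_polyfun (\<lambda>_. of_rat a)"
  unfolding rat_polyfun_def by (intro exI[of _ "[:a:]"]) simp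

lemma rat_polyfun_of_nat: "rat_polyfun (\<lambda>n. of_nat n)"
  unfolding rat_polyfun_def by (intro exI[of _ "[:0, 1:]"]) simp

lemma rat_polyfun_add:
  assumes "rat_polyfun f" "rat_polyfun g"
  shows "rat_polyfun (\<lambda>n. f n + g n)"
proof -
  from assms obtain p q where "\<And>n. f n = of_rat (poly p (of_nat n))" "\<And>n. g n = of_rat (poly q (of_nat n))"
    unfolding rat_polyfun_def by blast
  then show ?thesis unfolding rat_polyfun_def by (intro exI[of _ "p + q"]) (simp add: of_rat_add)
qed

lemma rat_polyfun_mult:
  assumes "rat_polyfun f" "rat_polyfun g"
  shows "rat_polyfun (\<lambda>n. f n * g n)"
proof -
  from assms obtain p q where "\<And>n. f n = of_rat (poly p (of_nat n))" "\<And>n. g n = of_rat (poly q (of_nat n))"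
    unfolding rat_polyfun_def by blast
  then show ?thesis unfolding rat_polyfun_def by (intro exI[of _ "p * q"]) (simp add: of_rat_mult)
qed

lemma rat_polyfun_sum:
  assumes "\<And>i. i \<in> A \<Longrightarrow> rat_polyfun (f i)"
  shows "rat_polyfun (\<lambda>n. \<Sum>i\<in>A. f i n)"
  using assms
proof (induction A rule: infinite_finite_induct)
  case (insert i A)
  then show ?case by (simp add: rat_polyfun_add)
qed (use rat_polyfun_of_rat[of 0] in simp_all)

lemma rat_polyfun_Suc:
  assumes "rat_polyfun f"
  shows "rat_polyfun (\<lambda>n. f (Suc n))"
proof -
  from assms obtain p where "\<And>n. f n = of_rat (poly p (of_nat n))"
    unfolding rat_polyfun_def by blast
  then show ?thesis unfolding rat_polyfun_def
    by (intro exI[of _ "p \<circ>\<^sub>p [:1, 1:]"]) (simp add: poly_pcompose)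
qed

lemma rat_polyfun_binomial: "rat_polyfun (\<lambda>n. of_nat (n choose m))"
proof (induction m)
  case 0
  then show ?case using rat_polyfun_of_rat[of 1] by simp
next
  case (Suc m)
  have "(of_nat (n choose Suc m) :: complex) = of_nat (n choose m) * ((of_nat n + of_rat (- of_nat m)) * of_rat (1 / of_nat (Suc m)))"
    for n
  proof -
    have "of_nat (n choose Suc m) * of_nat (Suc m) = (of_nat (n choose m) * (of_nat n - of_nat m) :: complex)"
    proof (cases "m \<le> n")
      case True
      have "(n choose Suc m) * Suc m = (n choose m) * (n - m)"
        using binomial_absorb_comp[of n m] binomial_absorption[of m n] by (simp add: mult_ac)
      then show ?thesis using True by (metis of_nat_diff of_nat_mult)
    qed (simp add: binomial_eq_0)
    then show ?thesis by (simp add: of_rat_divide of_rat_minus field_simps del: of_nat_Suc)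
  qed
  then show ?case
    using rat_polyfun_mult[OF Suc rat_polyfun_mult[OF rat_polyfun_add[OF rat_polyfun_of_nat rat_polyfun_of_rat] rat_polyfun_of_rat]]
    by simp
qed

text \<open>
  Telescoping \<open>(i + 1)\<^sup>k\<^sup>+\<^sup>1 - i\<^sup>k\<^sup>+\<^sup>1\<close> and expanding binomially expresses \<open>n\<^sup>k\<^sup>+\<^sup>1\<close> as \<open>k + 1\<close> times the sum of
  \<open>k\<close>-th powers plus a combination of sums of lower powers.
\<close>
lemma power_sum_poly: "\<exists>q::rat poly. \<forall>n. (\<Sum>i<n. of_nat i ^ k) = poly q (of_nat n)"
proof (induction k rule: less_induct)
  case (less k)
  then obtain Q :: "nat \<Rightarrow> rat poly" where
    Q: "\<And>j n. j < k \<Longrightarrow> (\<Sum>i<n. of_nat i ^ j) = poly (Q j) (of_nat n)" by metis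
  have "(\<Sum>i<n. of_nat i ^ k) =
      poly (smult (1 / of_nat (Suc k)) (monom 1 (Suc k) - (\<Sum>j<k. smult (of_nat (Suc k choose j)) (Q j)))) (of_nat n)"
    for n
  proof -
    have "(of_nat n :: rat) ^ Suc k = (\<Sum>i<n. of_nat (Suc i) ^ Suc k - of_nat i ^ Suc k)"
      by (subst sum_lessThan_telescope) simp
    also have "\<dots> = (\<Sum>i<n. \<Sum>j\<le>k. of_nat (Suc k choose j) * of_nat i ^ j)"
    proof (intro sum.cong refl)
      fix i
      have "(of_nat (Suc i) :: rat) ^ Suc k = (\<Sum>j\<le>Suc k. of_nat (Suc k choose j) * of_nat i ^ j)"
        using binomial_ring[of "of_nat i :: rat" 1 "Suc k"] by (simp add: add.commute)
      then show "(of_nat (Suc i) :: rat) ^ Suc k - of_nat i ^ Suc k = (\<Sum>j\<le>k. of_nat (Suc k choose j) * of_nat i ^ j)"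
        by simp
    qed
    also have "\<dots> = (\<Sum>j\<le>k. of_nat (Suc k choose j) * (\<Sum>i<n. of_nat i ^ j))"
      by (subst sum.swap) (simp add: sum_distrib_left)
    also have "\<dots> = of_nat (Suc k) * (\<Sum>i<n. of_nat i ^ k)
        + (\<Sum>j<k. of_nat (Suc k choose j) * poly (Q j) (of_nat n))"
      using Q by (simp add: lessThan_Suc_atMost[symmetric])
    finally show ?thesis
      by (simp add: poly_monom poly_sum field_simps del: of_nat_Suc power_Suc binomial_Suc_Suc)
  qed
  then show ?case by blast
qed

lemma rat_polyfun_partial_sums:
  assumes "rat_polyfun f"
  shows "rat_polyfun (\<lambda>n. \<Sum>i<n. f i)"
proof -
  from assms obtain p where p: "\<And>n. f n = of_rat (poly p (of_nat n))"
    unfolding rat_polyfun_def by blast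
  obtain Q :: "nat \<Rightarrow> rat poly" where
    Q: "\<And>j n. (\<Sum>i<n. of_nat i ^ j) = poly (Q j) (of_nat n)" using power_sum_poly by metis
  have "(\<Sum>i<n. poly p (of_nat i)) = poly (\<Sum>j\<le>degree p. smult (coeff p j) (Q j)) (of_nat n)" for n
    unfolding poly_altdef[of p] by (subst sum.swap) (simp add: poly_sum Q[symmetric] sum_distrib_left)
  then show ?thesis
    unfolding rat_polyfun_def p by (metis of_rat_sum)
qed

text \<open>
  The recurrence gives the increments of \<open>g\<^sub>r\<close> in terms of \<open>g\<^sub>0, \<dots>, g\<^bsub>r-1\<^esub>\<close>; summing them from the known
  value at 0 keeps the class of rational polynomial functions.
\<close>
lemma rat_polyfun_reciprocal_coeff: "rat_polyfun (reciprocal_coeff r)"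
proof (induction r rule: less_induct)
  case (less r)
  define f where "f n = (\<Sum>m=1..r. of_rat (- 1 / of_nat (Suc m)) * of_nat (n choose m) * reciprocal_coeff (r - m) (Suc n))" for n
  have "rat_polyfun f"
    unfolding f_def
    by (intro rat_polyfun_sum rat_polyfun_mult rat_polyfun_of_rat rat_polyfun_binomial rat_polyfun_Suc less) auto
  moreover have "reciprocal_coeff r n = of_rat (if r = 0 then 1 else 0) + (\<Sum>i<n. f i)" for n
  proof -
    have "f i = reciprocal_coeff r (Suc i) - reciprocal_coeff r i" for i
      unfolding reciprocal_coeff_Suc[of r i] f_def
      by (simp add: sum_negf[symmetric] of_rat_divide of_rat_minus of_rat_add)
    then show ?thesis by (simp add: sum_lessThan_telescope reciprocal_coeff_0_right)
  qed
  then have "reciprocal_coeff r = (\<lambda>n. of_rat (if r = 0 then 1 else 0) + (\<Sum>i<n. f i))" ..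
  ultimately show ?case
    using rat_polyfun_add[OF rat_polyfun_of_rat rat_polyfun_partial_sums] by simp
qed

section \<open>Explicit low-order coefficients\<close>

lemma binomial_low:
  "(of_nat (n choose 2) :: complex) = of_nat n * (of_nat n - 1) / 2"
  "(of_nat (n choose 3) :: complex) = of_nat n * (of_nat n - 1) * (of_nat n - 2) / 6"
  "(of_nat (n choose 4) :: complex) = of_nat n * (of_nat n - 1) * (of_nat n - 2) * (of_nat n - 3) / 24"
  unfolding binomial_gbinomial
  by (simp_all add: gbinomial_prod_rev eval_nat_numeral)

lemma reciprocal_coeff_1:
  "reciprocal_coeff 1 n = - (of_nat n ^ 2 - of_nat n) / 4"
proof (induction n)
  case (Suc n)
  have "reciprocal_coeff 1 (Suc n) = reciprocal_coeff 1 n - of_nat n / 2"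
    by (subst reciprocal_coeff_Suc) (simp add: reciprocal_coeff_0_left)
  also have "\<dots> = - (of_nat (Suc n) ^ 2 - of_nat (Suc n)) / 4"
    unfolding Suc.IH by (simp add: power2_eq_square field_simps)
  finally show ?case .
qed (simp add: reciprocal_coeff_0_right)

text \<open>
  In this formula and the next two, the denominator is \<open>4\<^sup>r r!\<close>, which is 32, 384 and 6144 for
  \<open>r = 2, 3, 4\<close>.
\<close>
lemma reciprocal_coeff_2:
  "reciprocal_coeff 2 n = (of_nat n ^ 4 - 22 / 9 * of_nat n ^ 3 + 13 / 3 * of_nat n ^ 2
      - 26 / 9 * of_nat n) / 32"
proof (induction n)
  case (Suc n)
  have "{1..2::nat} = {1, 2}" by auto
  then have "reciprocal_coeff 2 (Suc n) = reciprocal_coeff 2 n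
      - (of_nat n / 2 * reciprocal_coeff 1 (Suc n) + of_nat (n choose 2) / 3)"
    by (simp add: reciprocal_coeff_Suc[of 2] reciprocal_coeff_0_left)
  also have "\<dots> = (of_nat (Suc n) ^ 4 - 22 / 9 * of_nat (Suc n) ^ 3 + 13 / 3 * of_nat (Suc n) ^ 2
      - 26 / 9 * of_nat (Suc n)) / 32"
    unfolding Suc.IH reciprocal_coeff_1 binomial_low of_nat_Suc by (simp add: field_simps eval_nat_numeral)
  finally show ?case .
qed (simp add: reciprocal_coeff_0_right)

lemma reciprocal_coeff_3:
  "reciprocal_coeff 3 n = - (of_nat n ^ 6 - 13 / 3 * of_nat n ^ 5 + 43 / 3 * of_nat n ^ 4
      - 25 * of_nat n ^ 3 + 98 / 3 * of_nat n ^ 2 - 56 / 3 * of_nat n) / 384"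
proof (induction n)
  case (Suc n)
  have "{1..3::nat} = {1, 2, 3}" by auto
  then have "reciprocal_coeff 3 (Suc n) = reciprocal_coeff 3 n
      - (of_nat n / 2 * reciprocal_coeff 2 (Suc n) + of_nat (n choose 2) / 3 * reciprocal_coeff 1 (Suc n)
         + of_nat (n choose 3) / 4)"
    by (simp add: reciprocal_coeff_Suc[of 3] reciprocal_coeff_0_left)
  also have "\<dots> = - (of_nat (Suc n) ^ 6 - 13 / 3 * of_nat (Suc n) ^ 5 + 43 / 3 * of_nat (Suc n) ^ 4
      - 25 * of_nat (Suc n) ^ 3 + 98 / 3 * of_nat (Suc n) ^ 2 - 56 / 3 * of_nat (Suc n)) / 384"
    unfolding Suc.IH reciprocal_coeff_1 reciprocal_coeff_2 binomial_low of_nat_Suc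
    by (simp add: field_simps eval_nat_numeral)
  finally show ?case .
qed (simp add: reciprocal_coeff_0_right)

lemma reciprocal_coeff_4:
  "reciprocal_coeff 4 n = (of_nat n ^ 8 - 20 / 3 * of_nat n ^ 7 + 862 / 27 * of_nat n ^ 6
      - 21104 / 225 * of_nat n ^ 5 + 29039 / 135 * of_nat n ^ 4
      - 14548 / 45 * of_nat n ^ 3 + 9892 / 27 * of_nat n ^ 2
      - 42896 / 225 * of_nat n) / 6144"
proof (induction n)
  case (Suc n)
  have "{1..4::nat} = {1, 2, 3, 4}" by auto
  then have "reciprocal_coeff 4 (Suc n) = reciprocal_coeff 4 n
      - (of_nat n / 2 * reciprocal_coeff 3 (Suc n) + of_nat (n choose 2) / 3 * reciprocal_coeff 2 (Suc n)
         + of_nat (n choose 3) / 4 * reciprocal_coeff 1 (Suc n) + of_nat (n choose 4) / 5)"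
    by (simp add: reciprocal_coeff_Suc[of 4] reciprocal_coeff_0_left)
  also have "\<dots> = (of_nat (Suc n) ^ 8 - 20 / 3 * of_nat (Suc n) ^ 7 + 862 / 27 * of_nat (Suc n) ^ 6
      - 21104 / 225 * of_nat (Suc n) ^ 5 + 29039 / 135 * of_nat (Suc n) ^ 4
      - 14548 / 45 * of_nat (Suc n) ^ 3 + 9892 / 27 * of_nat (Suc n) ^ 2
      - 42896 / 225 * of_nat (Suc n)) / 6144"
    unfolding Suc.IH reciprocal_coeff_1 reciprocal_coeff_2 reciprocal_coeff_3 binomial_low of_nat_Suc
    by (simp add: field_simps eval_nat_numeral)
  finally show ?case .
qed (simp add: reciprocal_coeff_0_right)

theorem theorem3p2:
  fixes P :: "nat \<Rightarrow> nat \<Rightarrow> complex"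
  assumes P_def: "\<And>r N. N \<ge> r + 1 \<Longrightarrow>
    rademacher_coeff 0 1 (N - r) N = (-1) ^ (N + r) / (4 ^ r * fact N * fact r) * P r N"
  shows
    "(\<forall>r. \<exists>p :: rat poly. \<forall>N \<ge> r + 1. P r N = of_rat (poly p (of_nat N))) \<and>
     (\<forall>N \<ge> 1. P 0 N = 1) \<and>
     (\<forall>N \<ge> 2. P 1 N = of_nat N ^ 2 - of_nat N) \<and>
     (\<forall>N \<ge> 3. P 2 N = of_nat N ^ 4 - 22 / 9 * of_nat N ^ 3 + 13 / 3 * of_nat N ^ 2
                        - 26 / 9 * of_nat N) \<and>
     (\<forall>N \<ge> 4. P 3 N = of_nat N ^ 6 - 13 / 3 * of_nat N ^ 5 + 43 / 3 * of_nat N ^ 4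
                        - 25 * of_nat N ^ 3 + 98 / 3 * of_nat N ^ 2 - 56 / 3 * of_nat N) \<and>
     (\<forall>N \<ge> 5. P 4 N = of_nat N ^ 8 - 20 / 3 * of_nat N ^ 7 + 862 / 27 * of_nat N ^ 6
                        - 21104 / 225 * of_nat N ^ 5 + 29039 / 135 * of_nat N ^ 4
                        - 14548 / 45 * of_nat N ^ 3 + 9892 / 27 * of_nat N ^ 2
                        - 42896 / 225 * of_nat N)"
proof -
  have P: "P r N = of_rat ((- 4) ^ r * fact r) * reciprocal_coeff r N" if "N \<ge> r + 1" for r N
  proof -
    have "(-1) ^ N / fact N * reciprocal_coeff r N = (-1) ^ (N + r) / (4 ^ r * fact N * fact r) * P r N"
      using P_def[OF that] rademacher_coeff_at_1[of r N] that by simp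
    then have "reciprocal_coeff r N * (4 ^ r * fact r) = (-1) ^ r * P r N"
      by (simp add: power_add field_simps minus_one_power_iff split: if_splits)
    then have "P r N = (-1) ^ r * (reciprocal_coeff r N * (4 ^ r * fact r))"
      by (simp add: minus_one_power_iff split: if_splits)
    also have "\<dots> = ((-1) * 4) ^ r * fact r * reciprocal_coeff r N"
      unfolding power_mult_distrib by simp
    moreover have "(of_rat (fact r) :: complex) = fact r"
      by (metis of_nat_fact of_rat_of_nat_eq)
    ultimately show ?thesis by (simp add: of_rat_mult of_rat_power of_rat_minus)
  qed
  have "\<exists>p :: rat poly. \<forall>N \<ge> r + 1. P r N = of_rat (poly p (of_nat N))" for r
    using rat_polyfun_mult[OF rat_polyfun_of_rat rat_polyfun_reciprocal_coeff] P
    unfolding rat_polyfun_def by metis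
  moreover have "P 0 N = 1" if "N \<ge> 1" for N
    using that by (simp add: P reciprocal_coeff_0_left)
  ultimately show ?thesis
    by (auto simp: P reciprocal_coeff_1 reciprocal_coeff_2 reciprocal_coeff_3 reciprocal_coeff_4 fact_numeral
          simp del: One_nat_def)
qed

end
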